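(* There exist arbitrarily large finite subsets $A$ of $\mathbb{R}$ such that $N(A)>c_1$, where $c_1$ is a positive number depending only on $A$. That is, for every positive integer $K$ there exist a finite set $A\subset\mathbb{R}$ with at least $\max(K,3)$ elements and a real number $c_1=c_1(A)>0$ such that $N(A)>c_1$.
   Context: For $x,d\in\mathbb{R}$ with $d>0$, write $|x-d\mathbb{Z}|:=\min_{m\in\mathbb{Z}}|x-dm|$ for the distance from $x$ to $d\mathbb{Z}$. For a finite set $A=\{a_1,\dots,a_k\}\subset\mathbb{R}$ of $k\ge 3$ distinct points and $d>0$, $o\in\mathbb{R}$, define $$N_{d,o}(A)=\frac{\max_{1\le i\le k}|a_i-o-d\mathbb{Z}|}{d}\left(\frac{\max_{i<j}|a_i-a_j|}{d}\right)^{1/(k-2)}.$$ Put $N(A)=\inf_{d,o}N_{d,o}(A)$, where the infimum is taken over all $d\in\mathbb{R}$ with $0<d\le\mathrm{diam}(A)=\max_{i<j}|a_i-a_j|$ and all $o\in\mathbb{R}$. *)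

theory Defs
  imports "HOL-Analysis.Analysis"
begin

definition dist_to_multiples :: "real \<Rightarrow> real \<Rightarrow> real" where
  "dist_to_multiples x d = (INF m::int. \<bar>x - d * of_int m\<bar>)"

text \<open>For positive \<open>d\<close> the infimum above is a minimum.\<close>

lemma dist_to_multiples_attained:
  assumes "d > 0"
  shows "\<exists>m::int. dist_to_multiples x d = \<bar>x - d * of_int m\<bar> \<and>
                  (\<forall>n::int. \<bar>x - d * of_int m\<bar> \<le> \<bar>x - d * of_int n\<bar>)"
proof -
  define m where "m = round (x / d)"
  have scale: "\<bar>x - d * of_int n\<bar> = d * \<bar>x / d - of_int n\<bar>" for n :: int
  proof -
    have "x - d * of_int n = d * (x / d - of_int n)"
      using assms by (simp add: right_diff_distrib)
    then show ?thesis
      using assms by (simp add: abs_mult)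
  qed
  have le: "\<bar>x - d * of_int m\<bar> \<le> \<bar>x - d * of_int n\<bar>" for n :: int
    unfolding scale m_def using assms round_diff_minimal[of "x / d" n]
    by (simp add: abs_minus_commute)
  have "dist_to_multiples x d = \<bar>x - d * of_int m\<bar>"
    unfolding dist_to_multiples_def by (intro cInf_eq_minimum) (use le in auto)
  with le show ?thesis by blast
qed

definition max_gap :: "real set \<Rightarrow> real" where
  "max_gap A = Max {\<bar>a - b\<bar> | a b. a \<in> A \<and> b \<in> A \<and> a \<noteq> b}"

lemma finite_gaps: "finite A \<Longrightarrow> finite {\<bar>a - b\<bar> | a b. a \<in> A \<and> b \<in> A \<and> a \<noteq> b}"
  for A :: "real set"
  by (rule finite_subset[of _ "(\<lambda>(a, b). \<bar>a - b\<bar>) ` (A \<times> A)"]) auto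

lemma max_gap_eq_diameter:
  assumes "finite A" "card A \<ge> 2"
  shows "max_gap A = diameter A"
proof (rule antisym)
  let ?G = "{\<bar>a - b\<bar> | a b. a \<in> A \<and> b \<in> A \<and> a \<noteq> b}"
  obtain a b where ab: "a \<in> A" "b \<in> A" "a \<noteq> b"
    using assms card_le_Suc0_iff_eq[of A] by fastforce
  then have ne: "?G \<noteq> {}" by blast
  show "max_gap A \<le> diameter A"
    unfolding max_gap_def
  proof (rule Max.boundedI[OF finite_gaps[OF assms(1)] ne])
    fix g assume "g \<in> ?G"
    then show "g \<le> diameter A"
      using diameter_bounded_bound[OF finite_imp_bounded[OF assms(1)]]
      by (auto simp: dist_real_def)
  qed
  have gap: "\<bar>x - y\<bar> \<le> max_gap A" if "x \<in> A" "y \<in> A" "x \<noteq> y" for x y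
    unfolding max_gap_def by (rule Max_ge[OF finite_gaps[OF assms(1)]]) (use that in blast)
  show "diameter A \<le> max_gap A"
  proof (rule diameter_le)
    show "A \<noteq> {} \<or> 0 \<le> max_gap A" using ab by blast
    show "norm (x - y) \<le> max_gap A" if "x \<in> A" "y \<in> A" for x y
    proof (cases "x = y")
      case True
      then show ?thesis using gap[OF ab] by simp
    next
      case False
      then show ?thesis using gap[OF that] by simp
    qed
  qed
qed

definition N_at :: "real \<Rightarrow> real \<Rightarrow> real set \<Rightarrow> real" where
  "N_at d u A =
     Max ((\<lambda>a. dist_to_multiples (a - u) d) ` A) / d *
     (max_gap A / d) powr (1 / (real (card A) - 2))"

definition N_inf :: "real set \<Rightarrow> real" where
  "N_inf A = Inf {N_at d u A | d u. 0 < d \<and> d \<le> max_gap A}"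

text \<open>The infimum is over a nonempty set that is bounded below, so it is not affected by
  the arbitrary values of \<open>Inf\<close> on other sets of reals.\<close>

lemma N_inf_set_wf:
  assumes "finite A" "card A \<ge> 3"
  shows "{N_at d u A | d u. 0 < d \<and> d \<le> max_gap A} \<noteq> {}"
    and "bdd_below {N_at d u A | d u. 0 < d \<and> d \<le> max_gap A}"
proof -
  obtain a b where ab: "a \<in> A" "b \<in> A" "a \<noteq> b"
    using assms card_le_Suc0_iff_eq[of A] by fastforce
  have "\<bar>a - b\<bar> \<le> max_gap A"
    unfolding max_gap_def by (rule Max_ge[OF finite_gaps[OF assms(1)]]) (use ab in blast)
  with ab have "0 < max_gap A" by simp
  then show "{N_at d u A | d u. 0 < d \<and> d \<le> max_gap A} \<noteq> {}" by blast
  have "0 \<le> N_at d u A" if "0 < d" for d u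
  proof -
    have "0 \<le> dist_to_multiples (a - u) d"
      using dist_to_multiples_attained[OF that, of "a - u"] by auto
    also have "\<dots> \<le> Max ((\<lambda>a. dist_to_multiples (a - u) d) ` A)"
      using assms(1) ab by (intro Max_ge) auto
    finally show ?thesis
      using that unfolding N_at_def by simp
  qed
  then show "bdd_below {N_at d u A | d u. 0 < d \<and> d \<le> max_gap A}"
    by (intro bdd_belowI[of _ 0]) auto
qed

end

(*
  Take n = 2^r, theta = 2^(1/n) and A = {0, 1, theta^-1, ..., theta^-(n-1)}.  If all points of A are
  close to u + d Z, then there are integers m_i close to theta^-i / d.  At the conjugates z of theta,
  the number sum m_i z^i has size about n/d for z = theta; for the others it is small, because
  theta^-i is (up to the factor n) the basis dual to theta^i.  The product over all conjugates is
  an integer, nonzero since x^n - 2 is irreducible over Q, so the error cannot be too small.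
  With n a power of two, integrality of this norm follows by repeatedly applying
  P(x) P(-x) = Q(x^2), which also shows that the norm of P is odd when P(0) is odd.
*)
theory Submission
  imports Defs "HOL-Computational_Algebra.Polynomial"
begin

section \<open>Integrality and parity of norms at the 2^r-th roots of 2\<close>

text \<open>A predicate on complex polynomials, rather than a type of integer polynomials, lets
  \<open>poly\<close> be evaluated at complex roots without a coefficient map.\<close>

definition int_coeffs :: "complex poly \<Rightarrow> bool" where
  "int_coeffs p \<longleftrightarrow> (\<forall>i. coeff p i \<in> \<int>)"

lemma int_coeffs_pCons: "int_coeffs (pCons a p) \<longleftrightarrow> a \<in> \<int> \<and> int_coeffs p"
  by (auto simp: int_coeffs_def coeff_pCons split: nat.splits)

lemma int_coeffs_diff: "int_coeffs p \<Longrightarrow> int_coeffs q \<Longrightarrow> int_coeffs (p - q)"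
  by (simp add: int_coeffs_def)

lemma int_coeffs_mult: "int_coeffs p \<Longrightarrow> int_coeffs q \<Longrightarrow> int_coeffs (p * q)"
  by (auto simp: int_coeffs_def coeff_mult)

lemma poly_in_Ints: "int_coeffs p \<Longrightarrow> x \<in> \<int> \<Longrightarrow> poly p x \<in> \<int>"
  by (auto simp: int_coeffs_def poly_altdef)

lemma even_odd_parts:
  assumes "int_coeffs p"
  shows "\<exists>e o'. int_coeffs e \<and> int_coeffs o' \<and> coeff e 0 = coeff p 0 \<and>
           (\<forall>z. poly p z = poly e (z\<^sup>2) + z * poly o' (z\<^sup>2))"
  using assms
proof (induction p)
  case 0
  then show ?case by (intro exI[of _ 0]) auto
next
  case (pCons a p)
  then obtain e o' where "int_coeffs e" "int_coeffs o'"
    "\<forall>z. poly p z = poly e (z\<^sup>2) + z * poly o' (z\<^sup>2)"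
    by (auto simp: int_coeffs_pCons)
  with pCons.prems show ?case
    \<comment> \<open>Multiplication by z swaps parities: z (e(z^2) + z o'(z^2)) has even part z^2
      o'(z^2) and odd part e(z^2).\<close>
    by (intro exI[of _ "pCons a o'"] exI[of _ e])
       (auto simp: int_coeffs_pCons algebra_simps power2_eq_square)
qed

text \<open>With w = z^2 the product is e(w)^2 - w o'(w)^2. The second term vanishes at w = 0, so
  the constant coefficient is squared and keeps its parity.\<close>

lemma poly_mult_minus_arg:
  assumes "int_coeffs p"
  shows "\<exists>q. int_coeffs q \<and> coeff q 0 = (coeff p 0)\<^sup>2 \<and>
           (\<forall>z. poly p z * poly p (- z) = poly q (z\<^sup>2))"
proof -
  obtain e o' where eo: "int_coeffs e" "int_coeffs o'" "coeff e 0 = coeff p 0"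
    "\<forall>z. poly p z = poly e (z\<^sup>2) + z * poly o' (z\<^sup>2)"
    using even_odd_parts[OF assms] by blast
  let ?q = "e * e - pCons 0 (o' * o')"
  have "int_coeffs ?q"
    using eo by (intro int_coeffs_diff int_coeffs_mult) (auto simp: int_coeffs_pCons int_coeffs_mult)
  moreover have "coeff ?q 0 = (coeff p 0)\<^sup>2"
    using eo by (simp add: coeff_mult power2_eq_square)
  moreover have "\<forall>z. poly p z * poly p (- z) = poly ?q (z\<^sup>2)"
    using eo by (auto simp: algebra_simps power2_eq_square)
  ultimately show ?thesis by blast
qed

text \<open>Each root w of w^m = c has the two square roots \<open>csqrt w\<close> and
  \<open>- csqrt w\<close>, distinct because c, and hence w, is nonzero.\<close>

lemma prod_roots_double:
  assumes "m > 0" "c \<noteq> 0"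
  shows "(\<Prod>z | z ^ (2 * m) = c. f z) = (\<Prod>w | w ^ m = c. f (csqrt w) * f (- csqrt w))"
proof -
  let ?S = "{w. w ^ m = c}"
  have fin: "finite ?S" using assms by (intro finite_nth_roots)
  have inj: "inj_on csqrt ?S" "inj_on (\<lambda>w. - csqrt w) ?S"
    by (auto intro!: inj_onI) (metis power2_csqrt)+
  have split: "{z. z ^ (2 * m) = c} = csqrt ` ?S \<union> (\<lambda>w. - csqrt w) ` ?S"
  proof (intro equalityI subsetI)
    fix z assume "z \<in> {z. z ^ (2 * m) = c}"
    then have "z\<^sup>2 \<in> ?S" by (simp add: power_mult)
    moreover have "z = csqrt (z\<^sup>2) \<or> z = - csqrt (z\<^sup>2)"
      using power2_eq_iff[of z "csqrt (z\<^sup>2)"] by simp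
    ultimately show "z \<in> csqrt ` ?S \<union> (\<lambda>w. - csqrt w) ` ?S" by blast
  qed (auto simp: power_mult)
  have disj: "csqrt ` ?S \<inter> (\<lambda>w. - csqrt w) ` ?S = {}"
  proof (rule ccontr)
    assume "\<not> ?thesis"
    then obtain v w where vw: "v \<in> ?S" "csqrt v = - csqrt w"
      by blast
    then have "v = w"
      by (metis power2_csqrt power2_minus)
    with vw have "v = 0" by (simp add: eq_neg_iff_add_eq_0)
    with vw(1) assms show False by (simp add: power_0_left)
  qed
  show ?thesis
    unfolding split using fin inj disj
    by (subst prod.union_disjoint) (auto simp: prod.reindex prod.distrib)
qed

text \<open>Pairing z with -z halves the degree 2^r and replaces p by an integral polynomial in z^2,
  with constant coefficient of the same parity. After r such steps only the root 2 remains.\<close>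

lemma norm_root_two_integral:
  assumes "int_coeffs p" "coeff p 0 = of_int a"
  shows "\<exists>k::int. (\<Prod>z | z ^ (2 ^ r) = 2. poly p z) = of_int k \<and> (odd a \<longrightarrow> odd k)"
  using assms
proof (induction r arbitrary: p a)
  case 0
  obtain b p' where p: "p = pCons b p'" by (cases p)
  with 0 have b: "b = of_int a" "int_coeffs p'"
    by (auto simp: int_coeffs_pCons)
  then obtain k where "poly p' 2 = of_int k"
    using poly_in_Ints[of p' 2] by (auto elim: Ints_cases)
  with p b show ?case
    \<comment> \<open>The value at 2 is congruent to the constant coefficient modulo 2.\<close>
    by (intro exI[of _ "a + 2 * k"]) auto
next
  case (Suc r)
  obtain q where q: "int_coeffs q" "coeff q 0 = (coeff p 0)\<^sup>2"
    "\<forall>z. poly p z * poly p (- z) = poly q (z\<^sup>2)"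
    using poly_mult_minus_arg[OF Suc.prems(1)] by blast
  have "coeff q 0 = of_int (a\<^sup>2)" using q Suc.prems by simp
  from Suc.IH[OF q(1) this] show ?case
    using q(3) by (simp add: prod_roots_double)
qed

section \<open>Nonvanishing of the norm\<close>

text \<open>A 2-adic substitute for irreducibility. If all coefficients are even, halving them
  lowers the sum of absolute values. Otherwise, dividing by z^j for the first odd coefficient
  \<open>m j\<close> leaves an integral polynomial with odd constant term, whose norm is odd and
  therefore nonzero.\<close>

lemma root_two_linear_independent:
  fixes m :: "nat \<Rightarrow> int" and z :: complex
  assumes z: "z ^ (2 ^ r) = 2" and m: "\<exists>i<2 ^ r. m i \<noteq> 0"
  shows "(\<Sum>i<2 ^ r. of_int (m i) * z ^ i) \<noteq> 0"
  using m
proof (induction "\<Sum>i<(2::nat) ^ r. nat \<bar>m i\<bar>" arbitrary: m rule: less_induct)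
  case less
  let ?n = "(2::nat) ^ r"
  show ?case
  proof (cases "\<forall>i<?n. even (m i)")
    case True
    let ?h = "\<lambda>i. m i div 2"
    obtain i where i: "i < ?n" "m i \<noteq> 0" using less.prems by blast
    have "?h i \<noteq> 0" using i True by (auto elim!: evenE)
    moreover have "(\<Sum>i<?n. nat \<bar>?h i\<bar>) < (\<Sum>i<?n. nat \<bar>m i\<bar>)"
    proof (rule sum_strict_mono_ex1)
      show "\<forall>j\<in>{..<?n}. nat \<bar>?h j\<bar> \<le> nat \<bar>m j\<bar>"
        by auto
      show "\<exists>j\<in>{..<?n}. nat \<bar>?h j\<bar> < nat \<bar>m j\<bar>"
        using i \<open>m i div 2 \<noteq> 0\<close> True by (intro bexI[of _ i]) (auto elim!: evenE)
    qed simp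
    ultimately have "(\<Sum>i<?n. of_int (?h i) * z ^ i) \<noteq> 0"
      using less.hyps[of ?h] i by blast
    moreover have "(\<Sum>i<?n. of_int (m i) * z ^ i) = 2 * (\<Sum>i<?n. of_int (?h i) * z ^ i)"
      unfolding sum_distrib_left
      by (intro sum.cong refl) (use True in \<open>auto elim!: evenE\<close>)
    ultimately show ?thesis by simp
  next
    case False
    define j where "j = (LEAST i. i < ?n \<and> odd (m i))"
    have j: "j < ?n" "odd (m j)"
      using LeastI_ex[of "\<lambda>i. i < ?n \<and> odd (m i)"] False by (auto simp: j_def)
    have ev: "even (m i)" if "i < j" for i
      using not_less_Least[of i "\<lambda>i. i < ?n \<and> odd (m i)"] that j by (auto simp: j_def)
    \<comment> \<open>Substituting \<open>2 = z ^ n\<close> in the even coefficients below \<open>j\<close> makes \<open>z ^ j\<close> a common factor.\<close>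
    define c where "c i = (if i < j then m i div 2 else m i)" for i
    define e where "e i = (if i < j then ?n + i - j else i - j)" for i
    define p :: "complex poly" where "p = (\<Sum>i<?n. monom (of_int (c i)) (e i))"
    have "int_coeffs p"
      by (auto simp: int_coeffs_def p_def coeff_sum)
    moreover have "coeff p 0 = of_int (m j)"
    proof -
      \<comment> \<open>\<open>e i\<close> is 0 only for i = j: below j it equals n - (j - i) > 0,
        since j < n.\<close>
      have "coeff p 0 = (\<Sum>i<?n. if i = j then of_int (m j) else 0)"
        unfolding p_def coeff_sum
        by (intro sum.cong refl) (use j in \<open>auto simp: c_def e_def\<close>)
      then show ?thesis using j by simp
    qed
    ultimately obtain k :: int where "(\<Prod>z | z ^ ?n = 2. poly p z) = of_int k" "odd k"
      using norm_root_two_integral[of p "m j" r] j by blast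
    then have "(\<Prod>z | z ^ ?n = 2. poly p z) \<noteq> 0" by auto
    moreover have "finite {z::complex. z ^ ?n = 2}" by (intro finite_nth_roots) simp
    ultimately have "poly p z \<noteq> 0" using z by (auto simp: prod_zero_iff)
    moreover have "z \<noteq> 0" using z by (auto simp: power_0_left)
    moreover have "(\<Sum>i<?n. of_int (m i) * z ^ i) = z ^ j * poly p z"
      unfolding p_def poly_sum poly_monom sum_distrib_left
    proof (intro sum.cong refl)
      fix i
      show "of_int (m i) * z ^ i = z ^ j * (of_int (c i) * z ^ e i)"
      proof (cases "i < j")
        case True
        then obtain h where h: "m i = 2 * h" using ev by (auto elim: evenE)
        have "z ^ j * z ^ e i = z ^ (?n + i)"
          using True j by (simp add: e_def flip: power_add)
        also have "\<dots> = 2 * z ^ i" by (simp add: power_add z)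
        finally have "z ^ j * z ^ e i = 2 * z ^ i" .
        then show ?thesis using True h by (simp add: c_def mult.left_commute)
      next
        case False
        then have "z ^ j * z ^ e i = z ^ i"
          by (simp add: e_def flip: power_add)
        then show ?thesis using False by (simp add: c_def mult.left_commute)
      qed
    qed
    ultimately show ?thesis by simp
  qed
qed

lemma norm_root_two_ge_1:
  fixes m :: "nat \<Rightarrow> int"
  assumes "\<exists>i<2 ^ r. m i \<noteq> 0"
  shows "(\<Prod>z | z ^ (2 ^ r) = (2::complex). cmod (\<Sum>i<2 ^ r. of_int (m i) * z ^ i)) \<ge> 1"
proof -
  let ?n = "(2::nat) ^ r"
  define p :: "complex poly" where "p = (\<Sum>i<?n. monom (of_int (m i)) i)"
  have p: "int_coeffs p" "coeff p 0 = of_int (m 0)"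
    by (auto simp: int_coeffs_def p_def coeff_sum)
  have poly_p: "poly p z = (\<Sum>i<?n. of_int (m i) * z ^ i)" for z
    by (simp add: p_def poly_sum poly_monom)
  obtain k where k: "(\<Prod>z | z ^ ?n = 2. poly p z) = of_int k"
    using norm_root_two_integral[OF p, of r] by blast
  have "(\<Prod>z | z ^ ?n = 2. poly p z) \<noteq> 0"
    using root_two_linear_independent[OF _ assms]
    by (subst prod_zero_iff) (auto simp: poly_p intro: finite_nth_roots)
  with k have "k \<noteq> 0" by auto
  then have "1 \<le> cmod (of_int k)" by (simp add: norm_of_int)
  then show ?thesis
    unfolding k[symmetric] by (simp add: poly_p prod_norm)
qed

section \<open>Simultaneous approximation of the powers of 1/\<theta>\<close>

text \<open>Unless all \<open>m i\<close> vanish, the norm is at least 1. Its factor at \<theta> is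
  at most 3nq; each of the n - 1 other factors is pure approximation error, at most
  2n\<epsilon>.\<close>

lemma root_two_inverse_powers_badly_approximable:
  fixes q \<epsilon> :: real and m :: "nat \<Rightarrow> int" and r :: nat
  defines "n \<equiv> (2::nat) ^ r"
  defines "\<theta> \<equiv> root n 2"
  assumes q: "q \<ge> 1" and \<epsilon>: "\<epsilon> \<le> 1"
    and approx: "\<And>i. i < n \<Longrightarrow> \<bar>q / \<theta> ^ i - of_int (m i)\<bar> \<le> \<epsilon>"
  shows "1 \<le> (3 * n * q) * (2 * n * \<epsilon>) ^ (n - 1)"
proof -
  have n: "n > 0" by (simp add: n_def)
  have \<theta>: "\<theta> ^ n = 2" "\<theta> > 0" using n by (auto simp: \<theta>_def)
  have \<epsilon>0: "\<epsilon> \<ge> 0" using approx[of 0] n by linarith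
  show ?thesis
  proof (cases "\<exists>i<n. m i \<noteq> 0")
    case False
    \<comment> \<open>Index 0 gives q <= \<epsilon>, while \<epsilon> <= 1 <= q.\<close>
    then have "\<epsilon> = 1" "q = 1" using approx[of 0] n q \<epsilon> by auto
    moreover have "1 \<le> 3 * real n * (2 * real n) ^ (n - 1)"
      using n mult_mono[of 1 "3 * real n" 1 "(2 * real n) ^ (n - 1)"]
        one_le_power[of "2 * real n" "n - 1"] by simp
    ultimately show ?thesis by simp
  next
    case True
    let ?Z = "{z::complex. z ^ n = 2}"
    let ?y = "\<lambda>z::complex. \<Sum>i<n. of_int (m i) * z ^ i"
    let ?x = "\<lambda>z::complex. \<Sum>i<n. of_real (q / \<theta> ^ i) * z ^ i"
    have fin: "finite ?Z" using n by (intro finite_nth_roots)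
    have err: "cmod (?y z - ?x z) \<le> 2 * n * \<epsilon>" if "z ^ n = 2" for z
    proof -
      have nz: "cmod z ^ n = 2" using that by (metis norm_numeral norm_power)
      have z1: "cmod z \<ge> 1"
        using nz power_le_one[of "cmod z" n] by force
      have "cmod (?y z - ?x z) \<le>
          (\<Sum>i<n. cmod (of_real (of_int (m i) - q / \<theta> ^ i) * z ^ i))"
        by (rule order_trans[OF eq_refl norm_sum]) (simp add: sum_subtractf left_diff_distrib)
      also have "\<dots> \<le> (\<Sum>i<n. \<epsilon> * 2)"
      proof (rule sum_mono)
        fix i assume i: "i \<in> {..<n}"
        \<comment> \<open>All roots have modulus at least 1, so |z|^i <= |z|^n = 2.\<close>
        have "cmod z ^ i \<le> 2"
          using power_increasing[of i n "cmod z"] i z1 nz by simp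
        then show "cmod (of_real (of_int (m i) - q / \<theta> ^ i) * z ^ i) \<le> \<epsilon> * 2"
          unfolding norm_mult norm_power norm_of_real
          using approx[of i] i \<epsilon>0 by (intro mult_mono) (auto simp: abs_minus_commute)
      qed
      finally show ?thesis by (simp add: mult_ac)
    qed
    have main: "?x (of_real \<theta>) = of_real (n * q)"
      using \<theta>(2) by (simp flip: of_real_power)
    \<comment> \<open>Here z/\<theta> is a nontrivial n-th root of unity, so its geometric sum
      vanishes.\<close>
    have rest: "?x z = 0" if "z ^ n = 2" "z \<noteq> of_real \<theta>" for z
    proof -
      let ?w = "z / of_real \<theta>"
      have "?w ^ n = 1"
        using that \<theta> by (simp add: power_divide flip: of_real_power)
      moreover have "?w \<noteq> 1" using that \<theta> by auto
      ultimately have "(\<Sum>i<n. ?w ^ i) = 0" by (simp add: geometric_sum)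
      moreover have "?x z = of_real q * (\<Sum>i<n. ?w ^ i)"
        unfolding sum_distrib_left by (intro sum.cong refl) (simp add: power_divide)
      ultimately show ?thesis by simp
    qed
    have mem: "of_real \<theta> \<in> ?Z"
      using \<theta> by (simp flip: of_real_power)
    have "cmod (?y (of_real \<theta>)) \<le> cmod (?x (of_real \<theta>)) + 2 * n * \<epsilon>"
      using err[of "of_real \<theta>"] mem norm_triangle_sub[of "?y (of_real \<theta>)" "?x (of_real \<theta>)"]
      by simp
    also have "\<dots> = n * q + 2 * n * \<epsilon>"
      unfolding main norm_of_real using q by simp
    also have "\<dots> \<le> 3 * n * q"
      using mult_left_mono[of \<epsilon> q "2 * real n"] q \<epsilon> by (simp add: mult_ac)
    finally have bound: "cmod (?y (of_real \<theta>)) \<le> 3 * n * q" .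
    have "1 \<le> (\<Prod>z\<in>?Z. cmod (?y z))"
      using norm_root_two_ge_1[of r m] True by (simp add: n_def)
    also have "\<dots> = cmod (?y (of_real \<theta>)) * (\<Prod>z\<in>?Z - {of_real \<theta>}. cmod (?y z))"
      using fin mem by (rule prod.remove)
    also have "\<dots> \<le> (3 * n * q) * (\<Prod>z\<in>?Z - {complex_of_real \<theta>}. 2 * n * \<epsilon>)"
      using bound q err rest
      by (intro mult_mono prod_mono prod_nonneg) fastforce+
    also have "(\<Prod>z\<in>?Z - {complex_of_real \<theta>}. 2 * n * \<epsilon>) = (2 * n * \<epsilon>) ^ (n - 1)"
      using mem fin card_nth_roots[of 2 n] n by simp
    finally show ?thesis by simp
  qed
qed

section \<open>From approximation to a lower bound for N\<close>

lemma dist_to_multiples_le_half: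
  assumes "d > 0"
  shows "dist_to_multiples x d \<le> d / 2"
proof -
  obtain m where m: "dist_to_multiples x d = \<bar>x - d * of_int m\<bar>"
    "\<forall>n::int. \<bar>x - d * of_int m\<bar> \<le> \<bar>x - d * of_int n\<bar>"
    using dist_to_multiples_attained[OF assms] by blast
  have "\<bar>x - d * of_int m\<bar> \<le> \<bar>x - d * of_int (round (x / d))\<bar>"
    using m(2) by blast
  also have "\<dots> = d * \<bar>of_int (round (x / d)) - x / d\<bar>"
    using assms by (subst abs_minus_commute) (simp add: abs_mult_pos' field_simps)
  also have "\<dots> \<le> d / 2"
    using assms mult_left_mono[OF of_int_round_abs_le[of "x / d"], of d] by simp
  finally show ?thesis using m(1) by simp
qed

text \<open>The approximation bound is applied with q = 1/d, which is at least 1. Its (n - 1)-th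
  root produces the exponent of \<open>N_at\<close>, since k - 2 = n - 1 for k = n + 1
  points.\<close>

lemma N_at_root_two_lower_bound:
  fixes r :: nat and d u :: real
  defines "n \<equiv> (2::nat) ^ r"
  defines "A \<equiv> insert 0 ((\<lambda>i. 1 / root n 2 ^ i) ` {..<n})"
  assumes r: "r > 0" and d: "0 < d" "d \<le> 1" and A: "card A = n + 1" "max_gap A = 1"
  shows "1 / (4 * n * (3 * n) powr (1 / (n - 1))) \<le> N_at d u A"
proof -
  let ?D = "Max ((\<lambda>a. dist_to_multiples (a - u) d) ` A)"
  \<comment> \<open>The factor 2 pays for eliminating \<open>u\<close> by subtracting the
    approximation at the point 0. Since \<open>?D\<close> is at most d/2, \<epsilon> stays at most
    1.\<close>
  define \<epsilon> where "\<epsilon> = 2 * ?D / d"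
  have n: "n \<ge> 2" using r power_increasing[of 1 r "2::nat"] by (simp add: n_def)
  have fin: "finite A" by (simp add: A_def)
  have "?D \<le> d / 2"
    using fin dist_to_multiples_le_half[OF d(1)] by (subst Max_le_iff) (auto simp: A_def)
  then have \<epsilon>1: "\<epsilon> \<le> 1" using d by (simp add: \<epsilon>_def field_simps)
  have "\<exists>m::int. \<bar>a - u - d * of_int m\<bar> \<le> ?D" if "a \<in> A" for a
  proof -
    have "dist_to_multiples (a - u) d \<le> ?D" using fin that by (intro Max_ge) auto
    then show ?thesis using dist_to_multiples_attained[OF d(1), of "a - u"] by metis
  qed
  then obtain M :: "real \<Rightarrow> int" where M: "\<And>a. a \<in> A \<Longrightarrow> \<bar>a - u - d * of_int (M a)\<bar> \<le> ?D"
    by metis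
  define m where "m i = M (1 / root n 2 ^ i) - M 0" for i
  have approx: "\<bar>(1 / d) / root n 2 ^ i - of_int (m i)\<bar> \<le> \<epsilon>" if "i < n" for i
  proof -
    let ?a = "1 / root n 2 ^ i"
    have "\<bar>?a - d * of_int (m i)\<bar> \<le> 2 * ?D"
      using M[of ?a] M[of 0] that by (simp add: A_def m_def right_diff_distrib)
    moreover have "(1 / d) / root n 2 ^ i - of_int (m i) = (?a - d * of_int (m i)) / d"
      using d by (simp add: field_simps)
    ultimately show ?thesis
      using d by (simp add: \<epsilon>_def abs_divide divide_right_mono)
  qed
  have \<epsilon>0: "\<epsilon> \<ge> 0" using approx[of 0] n by linarith
  have "1 \<le> (3 * n * (1 / d)) * (2 * n * \<epsilon>) ^ (n - 1)"
    using root_two_inverse_powers_badly_approximable[of "1 / d" \<epsilon> r m] approx \<epsilon>1 d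
    by (simp add: n_def)
  then have "1 powr (1 / (n - 1)) \<le> ((3 * n * (1 / d)) * (2 * n * \<epsilon>) ^ (n - 1)) powr (1 / (n - 1))"
    by (intro powr_mono2) auto
  also have "\<dots> = (3 * n) powr (1 / (n - 1)) * (1 / d) powr (1 / (n - 1)) *
      ((2 * n * \<epsilon>) ^ (n - 1)) powr (1 / (n - 1))"
    using d \<epsilon>0 by (simp add: powr_mult powr_divide)
  also have "((2 * n * \<epsilon>) ^ (n - 1)) powr (1 / (n - 1)) = 2 * n * \<epsilon>"
    using n \<epsilon>0 root_powr_inverse[of "n - 1" "(2 * n * \<epsilon>) ^ (n - 1)"]
    by (simp add: real_root_power_cancel of_nat_diff)
  finally have "1 \<le> (3 * n) powr (1 / (n - 1)) * (1 / d) powr (1 / (n - 1)) * (2 * n * \<epsilon>)"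
    by simp
  \<comment> \<open>Regrouped so that \<epsilon>/2 = \<open>?D / d\<close> becomes the first factor
    of \<open>N_at\<close>.\<close>
  also have "\<dots> = \<epsilon> / 2 * (1 / d) powr (1 / (n - 1)) * (4 * n * (3 * n) powr (1 / (n - 1)))"
    by simp
  also have "\<epsilon> / 2 * (1 / d) powr (1 / (n - 1)) = N_at d u A"
    using n by (simp add: N_at_def A \<epsilon>_def of_nat_diff)
  finally have "1 \<le> N_at d u A * (4 * n * (3 * n) powr (1 / (n - 1)))" .
  then show ?thesis
    using n by (simp add: divide_le_eq)
qed

theorem theorem2p3:
  "\<forall>K::nat. K > 0 \<longrightarrow>
     (\<exists>A::real set. finite A \<and> card A \<ge> max K 3 \<and> (\<exists>c1::real. c1 > 0 \<and> N_inf A > c1))"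
proof (intro allI impI)
  fix K :: nat
  assume K: "K > 0"
  \<comment> \<open>The exponent K gives n > K and n >= 2, so the n + 1 points number at least both
    K and 3.\<close>
  define n where "n = (2::nat) ^ K"
  define \<eta> where "\<eta> = 1 / root n 2"
  define A where "A = insert 0 ((\<lambda>i. 1 / root n 2 ^ i) ` {..<n})"
  have n: "n \<ge> 2" "n > K"
    using K power_increasing[of 1 K "2::nat"] by (auto simp: n_def)
  have "root n 2 > 1" using n by simp
  then have \<eta>: "0 < \<eta>" "\<eta> < 1" by (auto simp: \<eta>_def)
  have A_eta: "A = insert 0 ((\<lambda>i. \<eta> ^ i) ` {..<n})"
    by (simp add: A_def \<eta>_def power_one_over)
  have fin: "finite A" by (simp add: A_def)
  have "inj_on (\<lambda>i. \<eta> ^ i) {..<n}"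
    using \<eta> by (auto intro!: inj_onI simp: power_inject_exp')
  then have card: "card A = n + 1"
    using \<eta> unfolding A_eta by (subst card_insert_disjoint) (auto simp: card_image)
  have sub: "A \<subseteq> {0..1}"
    using \<eta> by (auto simp: A_eta power_le_one)
  have "1 \<in> A" "0 \<in> A"
    using n by (auto simp: A_def intro!: image_eqI[of _ _ 0])
  then have gap: "max_gap A = 1"
    unfolding max_gap_def
  proof (intro Max_eqI finite_gaps[OF fin])
    show "y \<le> 1" if y: "y \<in> {\<bar>a - b\<bar> | a b. a \<in> A \<and> b \<in> A \<and> a \<noteq> b}" for y
    proof -
      obtain a b where "y = \<bar>a - b\<bar>" "a \<in> {0..1}" "b \<in> {0..1}"
        using y sub by blast
      then show ?thesis by auto
    qed
    show "1 \<in> {\<bar>a - b\<bar> | a b. a \<in> A \<and> b \<in> A \<and> a \<noteq> b}"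
      using \<open>1 \<in> A\<close> \<open>0 \<in> A\<close>
      by (intro CollectI exI[of _ 1] exI[of _ 0]) simp
  qed
  define c where "c = 1 / (4 * n * (3 * n) powr (1 / (n - 1)))"
  have "c > 0" using n by (simp add: c_def)
  have "c \<le> N_inf A"
    unfolding N_inf_def
  proof (rule cInf_greatest)
    show "{N_at d u A | d u. 0 < d \<and> d \<le> max_gap A} \<noteq> {}"
      using N_inf_set_wf(1)[OF fin] card n by simp
    show "c \<le> x" if "x \<in> {N_at d u A | d u. 0 < d \<and> d \<le> max_gap A}" for x
      using that N_at_root_two_lower_bound[OF K] card gap
      unfolding c_def A_def n_def by auto
  qed
  \<comment> \<open>Halving c makes the inequality strict.\<close>
  with \<open>c > 0\<close> have "c / 2 > 0" "N_inf A > c / 2" by auto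
  moreover have "card A \<ge> max K 3" using card n by simp
  ultimately show "\<exists>A::real set. finite A \<and> card A \<ge> max K 3 \<and> (\<exists>c1::real. c1 > 0 \<and> N_inf A > c1)"
    using fin by blast
qed

end
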